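(* Let $d\geq 2$ be an integer. Suppose that $E\subseteq\mathbb{R}^{d}$ is a universal differentiability set and that $(A_{i})_{i=1}^{\infty}$ is a collection of relatively closed subsets of $E$ satisfying $E=\bigcup_{i=1}^{\infty}A_{i}$. Then at least one of the sets $A_{i}$ is a universal differentiability set.
   Context: A set $S\subseteq\mathbb{R}^{d}$ is called a universal differentiability set if for every Lipschitz function $f:\mathbb{R}^{d}\to\mathbb{R}$ there is a point $x\in S$ at which $f$ is differentiable (as a function on $\mathbb{R}^d$). *)

theory Defs
  imports "HOL-Analysis.Analysis"
begin

definition universal_differentiability_set :: "(real ^ 'd) set \<Rightarrow> bool" where
  "universal_differentiability_set S \<longleftrightarrow>
     (\<forall>f :: real ^ 'd \<Rightarrow> real.
        (\<exists>L. L-lipschitz_on UNIV f) \<longrightarrow> (\<exists>x\<in>S. f differentiable (at x)))"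

end

theory Submission
  imports Defs
begin


text \<open>
  Suppose that no \<open>A i\<close> is a universal differentiability set, and let \<open>f i\<close> be a Lipschitz function
  that is differentiable at no point of \<open>A i\<close>. Write \<open>A i = E \<inter> C i\<close> with \<open>C i\<close> closed. A weighted sum
  of the \<open>f i\<close> need not be nowhere differentiable on \<open>E\<close>, since the singularities of different terms
  may cancel at a point. The terms are therefore modified so that at each point of \<open>E\<close> exactly one
  of them fails to be differentiable: at a point whose least index is \<open>n\<close>, that is the \<open>n\<close>-th term.

  Terms of smaller index are silenced by smoothing \<open>f i\<close> off \<open>C i\<close>
  (\<open>lipschitz_smoothing_off_closed\<close>): at a point \<open>x\<close> outside \<open>C i\<close>, the value \<open>f i x\<close> is replaced by
  an average of \<open>f i\<close> about \<open>x\<close> at a scale \<open>r x\<close>, where \<open>r\<close> is differentiable and bounded by the square of the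
  distance to \<open>C i\<close>. The result is differentiable off \<open>C i\<close> and differs from \<open>f i\<close> by a quadratically
  small quantity near \<open>C i\<close>, so that on \<open>C i\<close> it is differentiable exactly where \<open>f i\<close> is.

  Terms of larger index are silenced by multiplication: a bounded function times a function of the
  same kind as \<open>r\<close>, now for the closed set \<open>D = C 0 \<union> \<dots> \<union> C (i - 1)\<close>, has derivative zero on \<open>D\<close>, while
  off \<open>D\<close> the factor does not vanish and differentiability is unaffected. Boundedness is arranged by
  composition with \<open>arctan\<close>, a diffeomorphism onto its image. Both modifications together are
  \<open>localized_nondifferentiability\<close>.

  Finally, a series of Lipschitz functions with summable constants is differentiable wherever all its
  terms are (\<open>differentiable_lipschitz_series\<close>). Hence at a point of \<open>E\<close> with least index \<open>n\<close> the sum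
  is the \<open>n\<close>-th term plus a differentiable function, and is not differentiable. So \<open>E\<close> is not a
  universal differentiability set either.
\<close>

section \<open>Series of Lipschitz functions\<close>

lemma lipschitz_on_rangeD_abs:
  fixes f :: "'a::metric_space \<Rightarrow> real"
  assumes "L-lipschitz_on UNIV f"
  shows "\<bar>f x - f y\<bar> \<le> L * dist x y"
  using lipschitz_onD[OF assms, of x y] by (simp add: dist_real_def)

lemma lipschitz_has_derivative_bound:
  fixes f :: "'a::real_normed_vector \<Rightarrow> real"
  assumes L: "L-lipschitz_on UNIV f" and D: "(f has_derivative D) (at x)"
  shows "\<bar>D v\<bar> \<le> L * norm v"
proof -
  have lin: "linear D" using D has_derivative_linear by blast
  have "((\<lambda>t. f (x + t *\<^sub>R v)) has_derivative (\<lambda>t. D (t *\<^sub>R v))) (at 0)"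
    by (rule has_derivative_compose[of "\<lambda>t. x + t *\<^sub>R v" "\<lambda>t. t *\<^sub>R v" 0 UNIV f D])
       (auto intro!: derivative_eq_intros D)
  then have "((\<lambda>t. f (x + t *\<^sub>R v)) has_field_derivative D v) (at 0)"
    unfolding has_field_derivative_def
    by (rule has_derivative_eq_rhs) (auto simp: linear_scale[OF lin])
  then have "((\<lambda>t. (f (x + t *\<^sub>R v) - f x) / t) \<longlongrightarrow> D v) (at 0)"
    by (simp add: DERIV_def)
  then have lim: "((\<lambda>t. \<bar>(f (x + t *\<^sub>R v) - f x) / t\<bar>) \<longlongrightarrow> \<bar>D v\<bar>) (at 0)"
    by (rule tendsto_rabs)
  have "\<bar>(f (x + t *\<^sub>R v) - f x) / t\<bar> \<le> L * norm v" if "t \<noteq> 0" for t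
    using lipschitz_on_rangeD_abs[OF L, of "x + t *\<^sub>R v" x] that
    by (simp add: dist_norm field_simps)
  then show ?thesis
    by (intro tendsto_upperbound[OF lim]) (auto simp: eventually_at_filter)
qed

text \<open>
  The candidate derivative is the sum of the derivatives. The difference quotients of the remainders
  of the terms are dominated by \<open>2 * M k\<close>, uniformly in the second point, so Tannery's theorem
  allows the limit to be taken term by term. Termwise differentiation through uniform convergence of
  the derivatives would require them in a neighbourhood of \<open>x\<close>, where the terms may be singular.
\<close>
lemma differentiable_lipschitz_series:
  fixes h :: "nat \<Rightarrow> 'a::real_normed_vector \<Rightarrow> real"
  assumes lip: "\<And>k. (M k)-lipschitz_on UNIV (h k)"
    and bound: "\<And>k x. \<bar>h k x\<bar> \<le> M k"
    and sM: "summable M"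
    and diff: "\<And>k. h k differentiable (at x)"
  shows "(\<lambda>y. \<Sum>k. h k y) differentiable (at x)"
proof -
  have M0: "0 \<le> M k" for k using lipschitz_on_nonneg[OF lip] .
  have sh: "summable (\<lambda>k. h k y)" for y
    by (rule summable_comparison_test'[OF sM, of 0]) (use bound in auto)
  obtain D where D: "\<And>k. (h k has_derivative D k) (at x)"
    using diff unfolding differentiable_def by metis
  have Db: "\<bar>D k v\<bar> \<le> M k * norm v" for k v
    using lipschitz_has_derivative_bound[OF lip D] .
  have sD: "summable (\<lambda>k. D k v)" for v
    by (rule summable_comparison_test'[OF summable_mult2[OF sM, of "norm v"], of 0])
       (use Db in auto)
  have linD: "linear (D k)" for k using D has_derivative_linear by blast
  let ?S = "\<lambda>v. \<Sum>k. D k v"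
  let ?q = "\<lambda>k y. (h k y - h k x - D k (y - x)) / norm (y - x)"
  have bl: "bounded_linear ?S"
  proof (rule bounded_linear_intro[where K = "suminf M"])
    show "?S (u + v) = ?S u + ?S v" for u v
      by (simp add: linear_add[OF linD] suminf_add[OF sD sD])
    show "?S (c *\<^sub>R v) = c *\<^sub>R ?S v" for c v
      by (simp add: linear_scale[OF linD] suminf_mult[OF sD])
    show "norm (?S v) \<le> norm v * suminf M" for v
    proof -
      have "norm (?S v) \<le> (\<Sum>k. M k * norm v)"
        by (rule norm_suminf_le[OF _ summable_mult2[OF sM]]) (use Db in auto)
      then show ?thesis using suminf_mult2[OF sM, of "norm v"] by (simp add: mult.commute[of "norm v"])
    qed
  qed
  have lim: "((\<lambda>y. \<Sum>k. ?q k y) \<longlongrightarrow> (\<Sum>k. 0)) (at x)"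
  proof (cases "at x = bot")
    case False
    have "\<bar>?q k y\<bar> \<le> 2 * M k" for k y
    proof (cases "y = x")
      case True then show ?thesis using M0[of k] by simp
    next
      case False
      have "\<bar>h k y - h k x - D k (y - x)\<bar> \<le> 2 * M k * norm (y - x)"
        using lipschitz_on_rangeD_abs[OF lip, of k y x] Db[of k "y - x"]
        by (simp add: dist_norm)
      then show ?thesis using False by (simp add: field_simps)
    qed
    then show ?thesis
      by (intro tannerys_theorem[where M = "\<lambda>k. 2 * M k", THEN conjunct2, THEN conjunct2])
         (use D False summable_mult[OF sM, of 2] in \<open>auto simp: has_derivative_at_within divide_inverse
            ac_simps intro!: always_eventually\<close>)
  qed simp
  have "(\<Sum>k. ?q k y) = ((\<Sum>k. h k y) - (\<Sum>k. h k x) - ?S (y - x)) / norm (y - x)" for y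
    by (simp add: suminf_diff[OF sh sh] suminf_divide suminf_diff[OF summable_diff[OF sh sh] sD]
        summable_diff sh sD)
  then have "((\<lambda>y. \<Sum>k. h k y) has_derivative ?S) (at x)"
    using lim bl by (simp add: has_derivative_at_within divide_inverse ac_simps)
  then show ?thesis by (auto simp: differentiable_def)
qed

lemma lipschitz_on_series:
  fixes h :: "nat \<Rightarrow> 'a::real_normed_vector \<Rightarrow> real"
  assumes lip: "\<And>k. (M k)-lipschitz_on UNIV (h k)"
    and bound: "\<And>k x. \<bar>h k x\<bar> \<le> M k"
    and sM: "summable M"
  shows "(suminf M)-lipschitz_on UNIV (\<lambda>y. \<Sum>k. h k y)"
proof (rule lipschitz_onI)
  have M0: "0 \<le> M k" for k using lipschitz_on_nonneg[OF lip] .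
  show "0 \<le> suminf M" using M0 sM by (simp add: suminf_nonneg)
  have sh: "summable (\<lambda>k. h k y)" for y
    by (rule summable_comparison_test'[OF sM, of 0]) (use bound in auto)
  fix x y
  have "norm (\<Sum>k. h k x - h k y) \<le> (\<Sum>k. M k * dist x y)"
    by (rule norm_suminf_le[OF _ summable_mult2[OF sM]])
       (use lipschitz_on_rangeD_abs[OF lip] in auto)
  then show "dist (\<Sum>k. h k x) (\<Sum>k. h k y) \<le> suminf M * dist x y"
    by (simp add: dist_real_def suminf_diff[OF sh sh] suminf_mult2[OF sM])
qed

section \<open>A differentiable substitute for the squared distance to a closed set\<close>

lemma has_real_derivative_max0_square:
  "((\<lambda>t::real. (max 0 t)\<^sup>2) has_real_derivative 2 * max 0 t) (at t)"
proof -
  consider "t < 0" | "t = 0" | "0 < t" by linarith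
  then show ?thesis
  proof cases
    case 1
    have "((\<lambda>t::real. 0) has_real_derivative 0) (at t)" by simp
    then have "((\<lambda>t::real. (max 0 t)\<^sup>2) has_real_derivative 0) (at t)"
      by (rule has_field_derivative_transform_within_open[of _ _ _ "{..<0}"]) (use 1 in auto)
    then show ?thesis using 1 by simp
  next
    case 2
    have "((\<lambda>h. (max 0 h)\<^sup>2 / h) \<longlongrightarrow> (0::real)) (at 0)"
    proof (rule tendsto_sandwich[of "\<lambda>h. -\<bar>h\<bar>" _ _ "\<lambda>h. \<bar>h\<bar>"])
      show "((\<lambda>h. -\<bar>h\<bar>) \<longlongrightarrow> (0::real)) (at 0)" "((\<lambda>h. \<bar>h\<bar>) \<longlongrightarrow> (0::real)) (at 0)"
        by (auto intro!: tendsto_eq_intros)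
    qed (auto intro!: always_eventually simp: max_def power2_eq_square)
    then show ?thesis using 2 by (simp add: DERIV_def)
  next
    case 3
    have "((\<lambda>t::real. t\<^sup>2) has_real_derivative 2 * t) (at t)"
      by (auto intro!: derivative_eq_intros)
    then have "((\<lambda>t::real. (max 0 t)\<^sup>2) has_real_derivative 2 * t) (at t)"
      by (rule has_field_derivative_transform_within_open[of _ _ _ "{0<..}"]) (use 3 in auto)
    then show ?thesis using 3 by simp
  qed
qed

lemma has_derivative_radial_bump:
  fixes a :: "'a::real_inner"
  shows "((\<lambda>x. (max 0 (\<rho>\<^sup>2 - (norm (x - a))\<^sup>2))\<^sup>2) has_derivative
          (\<lambda>v. - 4 * max 0 (\<rho>\<^sup>2 - (norm (x - a))\<^sup>2) * ((x - a) \<bullet> v))) (at x)"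
proof -
  have "((\<lambda>x. \<rho>\<^sup>2 - (norm (x - a))\<^sup>2) has_derivative (\<lambda>v. - 2 * ((x - a) \<bullet> v))) (at x)"
    unfolding power2_norm_eq_inner
    by (auto intro!: derivative_eq_intros simp: inner_commute)
  from has_derivative_compose[OF this has_real_derivative_max0_square[unfolded has_field_derivative_def]]
  show ?thesis by (simp add: mult.assoc mult.left_commute)
qed

lemma lipschitz_radial_bump:
  fixes a :: "'a::real_inner"
  assumes "0 \<le> \<rho>" "\<rho> \<le> 1"
  shows "4-lipschitz_on UNIV (\<lambda>x. (max 0 (\<rho>\<^sup>2 - (norm (x - a))\<^sup>2))\<^sup>2)"
proof (rule bounded_derivative_imp_lipschitz)
  show "((\<lambda>x. (max 0 (\<rho>\<^sup>2 - (norm (x - a))\<^sup>2))\<^sup>2) has_derivative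
          (\<lambda>v. - 4 * max 0 (\<rho>\<^sup>2 - (norm (x - a))\<^sup>2) * ((x - a) \<bullet> v))) (at x within UNIV)" for x
    using has_derivative_radial_bump[of \<rho> a x] by simp
  fix x
  let ?m = "max 0 (\<rho>\<^sup>2 - (norm (x - a))\<^sup>2)"
  have m: "?m * norm (x - a) \<le> 1"
  proof (cases "norm (x - a) \<le> 1")
    case True
    have "\<rho>\<^sup>2 \<le> 1" using assms by (simp add: power_le_one)
    then have "?m \<le> 1"
      using zero_le_power2[of "norm (x - a)"] by (intro max.boundedI) linarith+
    then show ?thesis using True by (intro mult_le_one) auto
  next
    case False
    then have "1 \<le> (norm (x - a))\<^sup>2" by simp
    moreover have "\<rho>\<^sup>2 \<le> 1" using assms by (simp add: power_le_one)
    ultimately have "?m = 0" by (auto simp: max_def)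
    then show ?thesis by simp
  qed
  show "onorm (\<lambda>v. - 4 * ?m * ((x - a) \<bullet> v)) \<le> 4"
  proof (rule onorm_bound)
    fix v
    have "norm (- 4 * ?m * ((x - a) \<bullet> v)) = 4 * ?m * \<bar>(x - a) \<bullet> v\<bar>"
      by (simp add: abs_mult)
    also have "\<dots> \<le> 4 * ?m * (norm (x - a) * norm v)"
      by (intro mult_left_mono Cauchy_Schwarz_ineq2) auto
    also have "\<dots> = 4 * norm v * (?m * norm (x - a))" by (simp add: ac_simps)
    also have "\<dots> \<le> 4 * norm v * 1" using m by (intro mult_left_mono) auto
    finally show "norm (- 4 * ?m * ((x - a) \<bullet> v)) \<le> 4 * norm v" by simp
  qed simp
qed auto

text \<open>
  Centres \<open>a k\<close> run through a dense set, and each carries a radial bump supported on the largest ball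
  (of radius at most one) that avoids \<open>C\<close>. A bump is quadratic in the distance to the boundary of its
  ball, hence at most a multiple of the squared distance to any point of \<open>C\<close>, and a suitably weighted
  sum of the bumps keeps this bound.
\<close>
lemma closed_differentiable_gauge:
  fixes C :: "'a::euclidean_space set"
  assumes "closed C"
  obtains r :: "'a \<Rightarrow> real" and K where
    "\<And>x. r differentiable (at x)" "K-lipschitz_on UNIV r" "\<And>x. 0 \<le> r x" "\<And>x. r x \<le> 1"
    "\<And>x. r x = 0 \<longleftrightarrow> x \<in> C" "\<And>x c. c \<in> C \<Longrightarrow> r x \<le> (dist x c)\<^sup>2"
proof (cases "C = {}")
  \<comment> \<open>\<open>infdist x {} = 0\<close>, so the general construction would give the zero function here.\<close>
  case True
  then show ?thesis by (intro that[of "\<lambda>_. 1" 0] lipschitz_onI) auto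
next
  case False
  obtain D :: "'a set" where D: "countable D" "\<And>X. open X \<Longrightarrow> X \<noteq> {} \<Longrightarrow> \<exists>d\<in>D. d \<in> X"
    using countable_dense_setE by metis
  have "D \<noteq> {}" using D(2)[of UNIV] by auto
  define a where "a = from_nat_into D"
  have ra: "range a = D" unfolding a_def using \<open>D \<noteq> {}\<close> D(1) range_from_nat_into by metis
  define \<rho> where "\<rho> k = min 1 (infdist (a k) C)" for k
  have \<rho>: "0 \<le> \<rho> k" "\<rho> k \<le> 1" for k by (auto simp: \<rho>_def infdist_nonneg)
  define b where "b k x = (max 0 ((\<rho> k)\<^sup>2 - (norm (x - a k))\<^sup>2))\<^sup>2" for k x
  \<comment> \<open>Each bump is 4-Lipschitz and at most 4 times the squared distance; the weights
    \<open>(1/2)^(k+3)\<close> turn the sum of these constants into 1.\<close>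
  define M :: "nat \<Rightarrow> real" where "M k = 4 * (1/2)^(k+3)" for k
  define h where "h k x = (1/2)^(k+3) * b k x" for k x
  have b0: "0 \<le> b k x" for k x by (simp add: b_def)
  have b1: "b k x \<le> 1" for k x
  proof -
    have "(\<rho> k)\<^sup>2 \<le> 1" using \<rho> by (simp add: power_le_one)
    then have "max 0 ((\<rho> k)\<^sup>2 - (norm (x - a k))\<^sup>2) \<le> 1"
      using zero_le_power2[of "norm (x - a k)"] by (intro max.boundedI) linarith+
    then show ?thesis unfolding b_def by (simp add: power_le_one)
  qed
  have bdist: "b k x \<le> 4 * (dist x c)\<^sup>2" if "c \<in> C" for k x c
  proof (cases "norm (x - a k) < \<rho> k")
    case True
    let ?n = "norm (x - a k)"
    have "\<rho> k \<le> dist (a k) c" using infdist_le[OF that, of "a k"] by (simp add: \<rho>_def)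
    also have "\<dots> \<le> ?n + dist x c"
      using dist_triangle[of "a k" c x] by (simp add: dist_norm norm_minus_commute)
    finally have 1: "\<rho> k - ?n \<le> dist x c" by simp
    have "b k x = ((\<rho> k + ?n) * (\<rho> k - ?n))\<^sup>2"
      using True power_mono[of ?n "\<rho> k" 2]
      by (simp add: b_def max_def power2_eq_square algebra_simps)
    also have "\<dots> \<le> (2 * dist x c)\<^sup>2"
      using True 1 \<rho>[of k] by (intro power_mono mult_mono mult_nonneg_nonneg add_nonneg_nonneg) auto
    finally show ?thesis by (simp add: power_mult_distrib)
  next
    case False
    then have "(\<rho> k)\<^sup>2 \<le> (norm (x - a k))\<^sup>2" using \<rho> by (intro power_mono) auto
    then show ?thesis by (simp add: b_def)
  qed
  have M8: "M k = (1/2)^(k+1)" for k by (simp add: M_def power_add power3_eq_cube)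
  have sM: "M sums 1" unfolding M8 using power_half_series by simp
  have lip: "(M k)-lipschitz_on UNIV (h k)" for k
    using lipschitz_on_cmult_real[OF lipschitz_radial_bump[OF \<rho>, of k "a k"], of "(1/2)^(k+3)"]
    by (simp add: M_def h_def b_def mult.commute)
  have h0: "0 \<le> h k x" for k x using b0 by (simp add: h_def)
  have hM: "h k x \<le> M k" for k x
    using mult_left_mono[OF b1[of k x], of "(1/2)^(k+3)"] 
    by (simp add: h_def M_def)
  have sh: "summable (\<lambda>k. h k y)" for y
    by (rule summable_comparison_test'[OF sums_summable[OF sM], of 0]) (use h0 hM in auto)
  have dh: "h k differentiable (at x)" for k x
    unfolding h_def b_def differentiable_def
    using has_derivative_mult_right[OF has_derivative_radial_bump] by blast
  define r where "r x = (\<Sum>k. h k x)" for x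
  have r0: "0 \<le> r x" for x unfolding r_def by (rule suminf_nonneg[OF sh h0])
  have r1: "r x \<le> 1" for x
    unfolding r_def using suminf_le[OF hM sh sums_summable[OF sM]] sums_unique[OF sM] by simp
  have rd: "r x \<le> (dist x c)\<^sup>2" if "c \<in> C" for x c
  proof -
    have "h k x \<le> M k * (dist x c)\<^sup>2" for k
      using mult_left_mono[OF bdist[OF that, of k x], of "(1/2)^(k+3)"]
      by (simp add: h_def M_def)
    from suminf_le[OF this sh summable_mult2[OF sums_summable[OF sM]]]
    show ?thesis
      using suminf_mult2[OF sums_summable[OF sM], of "(dist x c)\<^sup>2"] sums_unique[OF sM]
      by (simp add: r_def)
  qed
  have rp: "0 < r x" if "x \<notin> C" for x
  proof -
    have i: "0 < infdist x C" using that assms False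
      by (simp add: infdist_pos_not_in_closed)
    define \<delta> where "\<delta> = min 1 (infdist x C) / 3"
    have \<delta>: "0 < \<delta>" "\<delta> < 1" "3 * \<delta> \<le> infdist x C" using i by (auto simp: \<delta>_def)
    obtain d where "d \<in> D" "d \<in> ball x \<delta>" using D(2)[of "ball x \<delta>"] \<delta> by auto
    then obtain k where k: "dist x (a k) < \<delta>" using ra by auto
    have "infdist x C \<le> infdist (a k) C + dist x (a k)" by (rule infdist_triangle)
    then have "\<delta> < \<rho> k" using \<delta> k by (simp add: \<rho>_def)
    then have "norm (x - a k) < \<rho> k" using k by (simp add: dist_norm)
    then have "(norm (x - a k))\<^sup>2 < (\<rho> k)\<^sup>2" by (intro power_strict_mono) auto
    then have "0 < h k x" by (simp add: h_def b_def max_def)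
    then show ?thesis unfolding r_def by (rule suminf_pos2[OF sh h0])
  qed
  show ?thesis
  proof (rule that[of r "suminf M"])
    show "r differentiable (at x)" for x
      unfolding r_def
      by (rule differentiable_lipschitz_series[OF lip _ sums_summable[OF sM] dh])
         (use h0 hM in auto)
    show "(suminf M)-lipschitz_on UNIV r"
      unfolding r_def
      by (rule lipschitz_on_series[OF lip _ sums_summable[OF sM]]) (use h0 hM in auto)
    show "r x = 0 \<longleftrightarrow> x \<in> C" for x
      using rp[of x] rd[of x x] r0[of x] by fastforce
  qed (use r0 r1 rd in auto)
qed


section \<open>Averages at a variable scale\<close>

definition bump_weight :: "'a::real_inner \<Rightarrow> real" where
  "bump_weight u = (max 0 (1 - (norm u)\<^sup>2))\<^sup>2"

abbreviation unit_cube :: "'a::euclidean_space set" where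
  "unit_cube \<equiv> cbox (- One) One"

text \<open>
  The case \<open>s = 0\<close> is included and gives \<open>f x\<close>, which makes the mean at a scale that vanishes on a
  closed set a single Lipschitz function on the whole space.
\<close>
definition local_mean :: "('a::euclidean_space \<Rightarrow> real) \<Rightarrow> 'a \<Rightarrow> real \<Rightarrow> real" where
  "local_mean f x s =
     integral unit_cube (\<lambda>u. f (x + s *\<^sub>R u) * bump_weight u) / integral unit_cube (bump_weight :: 'a \<Rightarrow> real)"

lemma continuous_on_bump_weight [continuous_intros]:
  "continuous_on S g \<Longrightarrow> continuous_on S (\<lambda>x. bump_weight (g x))"
  unfolding bump_weight_def by (intro continuous_intros)

lemma bump_weight_nonneg: "0 \<le> bump_weight u"
  by (simp add: bump_weight_def)

lemma integral_bump_weight_pos: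
  "0 < integral unit_cube (bump_weight :: 'a::euclidean_space \<Rightarrow> real)"
proof -
  have c: "continuous_on (unit_cube :: 'a set) (bump_weight :: 'a \<Rightarrow> real)"
    by (intro continuous_intros)
  have nn: "0 \<le> integral unit_cube (bump_weight :: 'a \<Rightarrow> real)"
    by (rule integral_nonneg[OF integrable_continuous[OF c]]) (rule bump_weight_nonneg)
  have "integral unit_cube (bump_weight :: 'a \<Rightarrow> real) \<noteq> 0"
  proof
    assume "integral unit_cube (bump_weight :: 'a \<Rightarrow> real) = 0"
    then have "((bump_weight :: 'a \<Rightarrow> real) has_integral 0) unit_cube"
      using integrable_integral[OF integrable_continuous[OF c]] by simp
    then have "bump_weight (0::'a) = 0"
      by (intro has_integral_0_cbox_imp_0[OF c])
         (auto simp: bump_weight_nonneg mem_box box_eq_empty box_ne_empty)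
    then show False by (simp add: bump_weight_def)
  qed
  then show ?thesis using nn by simp
qed

lemma norm_le_DIM_unit_cube:
  assumes "u \<in> (unit_cube :: 'a::euclidean_space set)"
  shows "norm u \<le> DIM('a)"
proof -
  have "norm u \<le> (\<Sum>b\<in>Basis. \<bar>u \<bullet> b\<bar>)" by (rule norm_le_l1)
  also have "\<dots> \<le> (\<Sum>b\<in>(Basis::'a set). 1)"
    using assms by (intro sum_mono) (auto simp: mem_box abs_le_iff)
  finally show ?thesis by simp
qed

text \<open>
  Since \<open>local_mean\<close> averages with weights that depend neither on the point nor on the scale,
  pointwise comparisons of the translated and rescaled functions carry over.
\<close>
lemma local_mean_diff_le:
  fixes f :: "'a::euclidean_space \<Rightarrow> real"
  assumes f: "continuous_on UNIV f"
    and le: "\<And>u. u \<in> unit_cube \<Longrightarrow> \<bar>f (x + s *\<^sub>R u) - f (y + t *\<^sub>R u)\<bar> \<le> B"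
  shows "\<bar>local_mean f x s - local_mean f y t\<bar> \<le> B"
proof -
  let ?w = "bump_weight :: 'a \<Rightarrow> real"
  let ?W = "integral unit_cube ?w"
  have cf: "continuous_on unit_cube (\<lambda>u. f (x + s *\<^sub>R u))" for x s
    by (rule continuous_on_compose2[OF f]) (auto intro!: continuous_intros)
  have int: "(\<lambda>u. f (x + s *\<^sub>R u) * ?w u) integrable_on unit_cube" for x s
    by (rule integrable_continuous) (intro continuous_intros cf)
  have "\<bar>integral unit_cube (\<lambda>u. f (x + s *\<^sub>R u) * ?w u) - integral unit_cube (\<lambda>u. f (y + t *\<^sub>R u) * ?w u)\<bar>
        = norm (integral unit_cube (\<lambda>u. (f (x + s *\<^sub>R u) - f (y + t *\<^sub>R u)) * ?w u))"
    using integral_diff[OF int int, of x s y t] by (simp add: algebra_simps)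
  also have "\<dots> \<le> integral unit_cube (\<lambda>u. B * ?w u)"
  proof (rule integral_norm_bound_integral)
    show "(\<lambda>u. (f (x + s *\<^sub>R u) - f (y + t *\<^sub>R u)) * ?w u) integrable_on unit_cube"
      by (rule integrable_continuous) (intro continuous_intros cf)
    show "(\<lambda>u. B * ?w u) integrable_on unit_cube"
      by (rule integrable_continuous) (intro continuous_intros)
    show "norm ((f (x + s *\<^sub>R u) - f (y + t *\<^sub>R u)) * ?w u) \<le> B * ?w u" if "u \<in> unit_cube" for u
      using mult_right_mono[OF le[OF that] bump_weight_nonneg, of u]
      by (simp add: abs_mult bump_weight_nonneg)
  qed
  also have "\<dots> = B * ?W" by simp
  finally show ?thesis
    using integral_bump_weight_pos[where 'a='a]
    by (simp add: local_mean_def flip: diff_divide_distrib) (simp add: abs_divide field_simps)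
qed

text \<open>
  Substituting \<open>z = x + s *\<^sub>R u\<close> moves the dependence on \<open>(x, s)\<close> out of the merely Lipschitz \<open>f\<close> and
  into a continuously differentiable kernel. The kernel vanishes outside the ball of radius \<open>s\<close>
  about \<open>x\<close>, so the domain of integration may be enlarged to a box independent of \<open>(x, s)\<close>.
  The exponent is the dimension plus the degree of homogeneity of the kernel in \<open>(z - x, s)\<close>.
\<close>
lemma integral_rescaled_kernel:
  fixes f :: "'a::euclidean_space \<Rightarrow> real"
  assumes f: "continuous_on UNIV f" and "0 < s"
    and sub: "cbox (x - s *\<^sub>R One) (x + s *\<^sub>R One) \<subseteq> cbox a b"
  shows "integral unit_cube (\<lambda>u. f (x + s *\<^sub>R u) * bump_weight u) =
     integral (cbox a b) (\<lambda>z. f z * (max 0 (s\<^sup>2 - (norm (z - x))\<^sup>2))\<^sup>2) / s ^ (DIM('a) + 4)"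
proof -
  let ?k = "\<lambda>z. f z * (max 0 (s\<^sup>2 - (norm (z - x))\<^sup>2))\<^sup>2"
  let ?Q = "cbox (x - s *\<^sub>R One) (x + s *\<^sub>R One)"
  have ck: "continuous_on S ?k" for S
    by (intro continuous_intros continuous_on_subset[OF f]) auto
  have 0: "?k z = 0" if "z \<notin> ?Q" for z
  proof -
    have "s \<le> norm (z - x)"
    proof (rule ccontr)
      assume "\<not> s \<le> norm (z - x)"
      then have "\<bar>(z - x) \<bullet> i\<bar> \<le> s" if "i \<in> Basis" for i
        using Basis_le_norm[OF that, of "z - x"] by simp
      then have "z \<in> ?Q" by (force simp: mem_box inner_diff_left inner_add_left abs_le_iff)
      with that show False by simp
    qed
    then have "s\<^sup>2 \<le> (norm (z - x))\<^sup>2" using \<open>0 < s\<close> by (intro power_mono) auto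
    then show ?thesis by simp
  qed
  have img: "(\<lambda>z. (1 / s) *\<^sub>R z + - ((1 / s) *\<^sub>R x)) ` ?Q = unit_cube"
  proof -
    have "?Q \<noteq> {}" using \<open>0 < s\<close> by (simp add: box_ne_empty inner_diff_left inner_add_left)
    then show ?thesis using \<open>0 < s\<close>
      by (subst image_affinity_cbox) (auto simp: algebra_simps)
  qed
  have "(?k has_integral integral ?Q ?k) ?Q"
    using integrable_integral[OF integrable_continuous[OF ck]] .
  from has_integral_on_superset[OF this 0 sub]
  have 1: "integral (cbox a b) ?k = integral ?Q ?k" by (rule integral_unique)
  have "((\<lambda>u. ?k (s *\<^sub>R u + x)) has_integral (1 / s ^ DIM('a)) *\<^sub>R integral ?Q ?k) unit_cube"
    using has_integral_affinity[OF \<open>(?k has_integral integral ?Q ?k) ?Q\<close>, of s x] \<open>0 < s\<close>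
    unfolding img by simp
  moreover have "?k (s *\<^sub>R u + x) = s ^ 4 * (f (x + s *\<^sub>R u) * bump_weight u)" for u
  proof -
    have "max 0 (s\<^sup>2 - (norm (s *\<^sub>R u))\<^sup>2) = s\<^sup>2 * max 0 (1 - (norm u)\<^sup>2)"
      using \<open>0 < s\<close>
      by (simp add: max_def power_mult_distrib algebra_simps zero_le_mult_iff)
    then show ?thesis
      by (simp add: bump_weight_def power_mult_distrib add.commute)
  qed
  ultimately have "((\<lambda>u. s ^ 4 * (f (x + s *\<^sub>R u) * bump_weight u)) has_integral (1 / s ^ DIM('a)) *\<^sub>R integral ?Q ?k) unit_cube"
    by simp
  from has_integral_mult_right[OF this, of "1 / s ^ 4"]
  have "((\<lambda>u. f (x + s *\<^sub>R u) * bump_weight u) has_integral (1 / s ^ 4) * ((1 / s ^ DIM('a)) *\<^sub>R integral ?Q ?k)) unit_cube"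
    using \<open>0 < s\<close> by simp
  then show ?thesis unfolding 1 using \<open>0 < s\<close>
    by (simp add: integral_unique power_add mult.commute)
qed

text \<open>
  The mean is differentiable jointly in point and scale, as differentiation under the integral sign
  falls on the kernel alone. Joint differentiability is what the chain rule needs for
  a scale that varies with the point.
\<close>
lemma local_mean_differentiable:
  fixes f :: "'a::euclidean_space \<Rightarrow> real"
  assumes f: "continuous_on UNIV f" and "0 < s"
  shows "(\<lambda>p. local_mean f (fst p) (snd p)) differentiable (at (x, s))"
proof -
  \<comment> \<open>Every \<open>p\<close> within distance \<open>s\<close> of \<open>(x, s)\<close> has its point within \<open>s\<close> of \<open>x\<close> and a scale below
    \<open>2 * s\<close>, so the half width \<open>3 * s\<close> makes one box serve all of them.\<close>
  define a where "a = x - (3 * s) *\<^sub>R One"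
  define b where "b = x + (3 * s) *\<^sub>R One"
  define U where "U = ball (x, s) s"
  let ?m = "\<lambda>p z. max 0 ((snd p)\<^sup>2 - (norm (z - fst p))\<^sup>2)"
  let ?K = "\<lambda>p z. f z * (?m p z)\<^sup>2"
  define F where "F p z = (f z * (2 * ?m p z)) *\<^sub>R blinfun_inner_right (2 *\<^sub>R (z - fst p), 2 * snd p)"
    for p :: "'a \<times> real" and z
  have U: "(x, s) \<in> U" "open U" "convex U" using \<open>0 < s\<close> by (auto simp: U_def)
  have inU: "0 < snd p \<and> cbox (fst p - snd p *\<^sub>R One) (fst p + snd p *\<^sub>R One) \<subseteq> cbox a b"
    if "p \<in> U" for p
  proof -
    have "dist x (fst p) < s" "dist s (snd p) < s"
      using that dist_fst_le[of "(x,s)" p] dist_snd_le[of "(x,s)" p] by (auto simp: U_def)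
    then have s: "0 < snd p" "snd p < 2 * s" and n: "norm (x - fst p) < s"
      by (auto simp: dist_real_def dist_norm)
    have "a \<bullet> i \<le> (fst p - snd p *\<^sub>R One) \<bullet> i \<and> (fst p + snd p *\<^sub>R One) \<bullet> i \<le> b \<bullet> i"
      if "i \<in> Basis" for i
    proof -
      have "\<bar>x \<bullet> i - fst p \<bullet> i\<bar> < s"
        using Basis_le_norm[OF that, of "x - fst p"] n by (simp add: inner_diff_left)
      then show ?thesis
        using s that by (simp add: a_def b_def inner_diff_left inner_add_left abs_less_iff)
    qed
    then have "cbox (fst p - snd p *\<^sub>R One) (fst p + snd p *\<^sub>R One) \<subseteq> cbox a b"
      by (intro subset_box_imp(1)) blast
    with s show ?thesis by simp
  qed
  have "((\<lambda>p. integral (cbox a b) (?K p)) has_derivative integral (cbox a b) (F (x, s))) (at (x, s) within U)"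
  proof (rule leibniz_rule[OF _ _ _ U(1,3)])
    fix p z
    have "((\<lambda>p. (snd p)\<^sup>2 - (norm (z - fst p))\<^sup>2) has_derivative
        (\<lambda>v. (2 *\<^sub>R (z - fst p), 2 * snd p) \<bullet> v)) (at p within U)"
      unfolding power2_norm_eq_inner
      by (auto intro!: derivative_eq_intros simp: inner_prod_def inner_commute algebra_simps)
    from has_derivative_compose[OF this has_real_derivative_max0_square[unfolded has_field_derivative_def]]
    have "((\<lambda>p. (?m p z)\<^sup>2) has_derivative (\<lambda>v. 2 * ?m p z * ((2 *\<^sub>R (z - fst p), 2 * snd p) \<bullet> v))) (at p within U)" .
    from has_derivative_mult_right[OF this, of "f z"]
    show "((\<lambda>p. ?K p z) has_derivative blinfun_apply (F p z)) (at p within U)"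
      by (rule has_derivative_eq_rhs) (auto simp: F_def scaleR_blinfun.rep_eq blinfun_inner_right.rep_eq ac_simps)
  next
    fix p
    show "?K p integrable_on cbox a b"
      by (intro integrable_continuous continuous_intros continuous_on_subset[OF f]) auto
  next
    show "continuous_on (U \<times> cbox a b) (\<lambda>(p, z). F p z)"
      unfolding F_def split_beta
      by (intro continuous_intros continuous_on_compose2[OF f] 
          bounded_linear.continuous_on[OF bounded_linear_blinfun_inner_right]) auto
  qed
  then have D: "(\<lambda>p. integral (cbox a b) (?K p)) differentiable (at (x, s))"
    using U at_within_open[OF U(1,2)] by (auto simp: differentiable_def)
  let ?H = "\<lambda>p. integral (cbox a b) (?K p) / (snd p) ^ (DIM('a) + 4)
      / integral unit_cube (bump_weight :: 'a \<Rightarrow> real)"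
  have "?H differentiable (at (x, s))"
    using D \<open>0 < s\<close> integral_bump_weight_pos[where 'a='a]
      bounded_linear_imp_differentiable[OF bounded_linear_snd]
    by (intro differentiable_divide differentiable_power differentiable_const) auto
  then obtain H' where H': "(?H has_derivative H') (at (x, s))" unfolding differentiable_def ..
  have "?H p = local_mean f (fst p) (snd p)" if "p \<in> U" for p
    using integral_rescaled_kernel[OF f conjunct1[OF inU[OF that]] conjunct2[OF inU[OF that]]]
    by (simp add: local_mean_def)
  from has_derivative_transform_within_open[OF H' U(2,1) this]
  show ?thesis unfolding differentiable_def by blast
qed

section \<open>Localizing the points of non-differentiability\<close>

lemma has_derivative_zero_if_quadratic:
  fixes e :: "'a::real_normed_vector \<Rightarrow> real"
  assumes "\<And>y. \<bar>e y\<bar> \<le> K * (dist y c)\<^sup>2"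
  shows "(e has_derivative (\<lambda>_. 0)) (at c)"
proof (rule has_derivativeI_sandwich[of 1 _ UNIV c e "\<lambda>y. K * norm (y - c)"])
  have "e c = 0" using assms[of c] by simp
  fix y assume "y \<noteq> c"
  then show "norm (e y - e c - 0) / norm (y - c) \<le> K * norm (y - c)"
    using assms[of y] \<open>e c = 0\<close> by (simp add: dist_norm power2_eq_square field_simps)
next
  have "((\<lambda>y. K * norm (y - c)) \<longlongrightarrow> K * norm (c - c)) (at c)"
    by (intro tendsto_intros)
  then show "((\<lambda>y. K * norm (y - c)) \<longlongrightarrow> 0) (at c)" by simp
qed auto

text \<open>
  The smoothing is the mean of \<open>f\<close> at the scale \<open>r x\<close>. It is Lipschitz because \<open>f\<close> and \<open>r\<close> are, and
  it differs from \<open>f\<close> by at most a multiple of \<open>r\<close>, hence of the squared distance to any point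
  of \<open>C\<close>; such an error has derivative zero on \<open>C\<close>.
\<close>
lemma lipschitz_smoothing_off_closed:
  fixes f :: "'a::euclidean_space \<Rightarrow> real"
  assumes "closed C" and L: "L-lipschitz_on UNIV f"
  obtains g :: "'a \<Rightarrow> real" and L' where "L'-lipschitz_on UNIV g" "\<And>x. x \<notin> C \<Longrightarrow> g differentiable (at x)"
    "\<And>x. x \<in> C \<Longrightarrow> g differentiable (at x) \<longleftrightarrow> f differentiable (at x)"
proof -
  obtain r :: "'a \<Rightarrow> real" and K where dr: "\<And>x. r differentiable (at x)"
    and K: "K-lipschitz_on UNIV r" and r0: "\<And>x. 0 \<le> r x"
    and rC: "\<And>x. r x = 0 \<longleftrightarrow> x \<in> C" and rd: "\<And>x c. c \<in> C \<Longrightarrow> r x \<le> (dist x c)\<^sup>2"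
    using closed_differentiable_gauge[OF \<open>closed C\<close>] by metis
  let ?d = "real DIM('a)"
  have L0: "0 \<le> L" and K0: "0 \<le> K" using lipschitz_on_nonneg L K by auto
  have cf: "continuous_on UNIV f" using L lipschitz_on_continuous_on by blast
  have move: "\<bar>f (x + s *\<^sub>R u) - f (y + t *\<^sub>R u)\<bar> \<le> L * (dist x y + \<bar>s - t\<bar> * ?d)"
    if "u \<in> unit_cube" for x y s t and u :: 'a
  proof -
    have "dist (x + s *\<^sub>R u) (y + t *\<^sub>R u) = norm ((x - y) + (s - t) *\<^sub>R u)"
      by (simp add: dist_norm algebra_simps)
    also have "\<dots> \<le> dist x y + \<bar>s - t\<bar> * norm u"
      using norm_triangle_ineq[of "x - y" "(s - t) *\<^sub>R u"] by (simp add: dist_norm)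
    also have "\<dots> \<le> dist x y + \<bar>s - t\<bar> * ?d"
      using norm_le_DIM_unit_cube[OF that] by (intro add_left_mono mult_left_mono) auto
    finally show ?thesis
      using lipschitz_on_rangeD_abs[OF L, of "x + s *\<^sub>R u" "y + t *\<^sub>R u"] L0
      by (meson mult_left_mono order_trans)
  qed
  define g where "g x = local_mean f x (r x)" for x
  have "(L * (1 + K * ?d))-lipschitz_on UNIV g"
  proof (rule lipschitz_onI)
    fix x y
    have "\<bar>g x - g y\<bar> \<le> L * (dist x y + \<bar>r x - r y\<bar> * ?d)"
      unfolding g_def by (rule local_mean_diff_le[OF cf move])
    also have "\<dots> \<le> L * (dist x y + (K * dist x y) * ?d)"
      using lipschitz_on_rangeD_abs[OF K] L0
      by (intro mult_left_mono add_left_mono mult_right_mono) auto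
    finally show "dist (g x) (g y) \<le> L * (1 + K * ?d) * dist x y"
      by (simp add: dist_real_def algebra_simps)
  qed (use L0 K0 in auto)
  moreover have "g differentiable (at x)" if "x \<notin> C" for x
  proof -
    have "0 < r x" using that r0[of x] rC[of x] by linarith
    obtain G where G: "((\<lambda>p. local_mean f (fst p) (snd p)) has_derivative G) (at (x, r x))"
      using local_mean_differentiable[OF cf \<open>0 < r x\<close>, of x] by (auto simp: differentiable_def)
    obtain R where R: "(r has_derivative R) (at x)" using dr by (auto simp: differentiable_def)
    have "((\<lambda>y. (y, r y)) has_derivative (\<lambda>v. (v, R v))) (at x)"
      by (intro derivative_intros R)
    from has_derivative_compose[OF this G] show ?thesis
      by (auto simp: g_def[abs_def] differentiable_def)
  qed
  moreover have "g differentiable (at c) \<longleftrightarrow> f differentiable (at c)" if "c \<in> C" for c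
  proof -
    have "\<bar>g y - f y\<bar> \<le> (L * ?d) * (dist y c)\<^sup>2" for y
    proof -
      have "local_mean f y 0 = f y"
        using integral_bump_weight_pos[where 'a='a] by (simp add: local_mean_def)
      then have "\<bar>g y - f y\<bar> \<le> L * (dist y y + \<bar>r y - 0\<bar> * ?d)"
        unfolding g_def using local_mean_diff_le[OF cf move, of y "r y" y 0] by simp
      also have "\<dots> \<le> L * ((dist y c)\<^sup>2 * ?d)"
        using rd[OF that, of y] r0[of y] L0 by (intro mult_left_mono) (auto intro: mult_right_mono)
      finally show ?thesis by (simp add: ac_simps)
    qed
    then have d: "(\<lambda>y. g y - f y) differentiable (at c)"
      by (rule differentiableI[OF has_derivative_zero_if_quadratic])
    show ?thesis
      using differentiable_add[OF _ d, of f] differentiable_diff[OF _ d, of g] by auto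
  qed
  ultimately show ?thesis by (rule that)
qed

lemma differentiable_arctan_iff:
  fixes f :: "'a::real_normed_vector \<Rightarrow> real"
  shows "(\<lambda>x. arctan (f x)) differentiable (at x) \<longleftrightarrow> f differentiable (at x)"
proof
  assume "(\<lambda>x. arctan (f x)) differentiable (at x)"
  then obtain D where "((\<lambda>x. arctan (f x)) has_derivative D) (at x)"
    by (auto simp: differentiable_def)
  from has_derivative_compose[OF this DERIV_tan[OF cos_arctan_not_zero, unfolded has_field_derivative_def]]
  show "f differentiable (at x)" by (auto simp: differentiable_def tan_arctan)
next
  assume "f differentiable (at x)"
  then obtain D where "(f has_derivative D) (at x)" by (auto simp: differentiable_def)
  from has_derivative_compose[OF this DERIV_arctan[unfolded has_field_derivative_def]]
  show "(\<lambda>x. arctan (f x)) differentiable (at x)" by (auto simp: differentiable_def)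
qed

lemma lipschitz_arctan: "1-lipschitz_on UNIV (arctan :: real \<Rightarrow> real)"
proof (rule bounded_derivative_imp_lipschitz)
  show "(arctan has_derivative (*) (inverse (1 + x\<^sup>2))) (at x within UNIV)" for x :: real
    using DERIV_arctan[of x] by (simp add: has_field_derivative_def)
  show "onorm ((*) (inverse (1 + x\<^sup>2))) \<le> 1" for x :: real
  proof (rule onorm_bound)
    fix y :: real
    have "inverse (1 + x\<^sup>2) \<le> 1" by (simp add: inverse_le_1_iff)
    then have "inverse (1 + x\<^sup>2) * \<bar>y\<bar> \<le> 1 * \<bar>y\<bar>" by (intro mult_right_mono) auto
    then show "norm (inverse (1 + x\<^sup>2) * y) \<le> 1 * norm y"
      by (simp add: abs_mult add_nonneg_nonneg)
  qed simp
qed auto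

text \<open>
  The function \<open>g\<close> is a multiple of \<open>r x * arctan (F x)\<close>, where \<open>F\<close> smooths \<open>f\<close> off \<open>C\<close> and \<open>r\<close> is a gauge
  of \<open>D\<close>. The product vanishes quadratically at \<open>D\<close>, and off \<open>D\<close> division by \<open>r\<close> and application
  of \<open>tan\<close> recover \<open>F\<close>.
\<close>
lemma localized_nondifferentiability:
  fixes f :: "'a::euclidean_space \<Rightarrow> real"
  assumes "closed C" "closed D" "L-lipschitz_on UNIV f"
    and nd: "\<And>x. x \<in> A \<Longrightarrow> \<not> f differentiable (at x)" and "A \<subseteq> C"
  obtains g :: "'a \<Rightarrow> real" where "1-lipschitz_on UNIV g" "\<And>x. \<bar>g x\<bar> \<le> 1"
    "\<And>x. x \<notin> C \<or> x \<in> D \<Longrightarrow> g differentiable (at x)"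
    "\<And>x. x \<in> A - D \<Longrightarrow> \<not> g differentiable (at x)"
proof -
  obtain F :: "'a \<Rightarrow> real" and L' where F: "L'-lipschitz_on UNIV F" "\<And>x. x \<notin> C \<Longrightarrow> F differentiable (at x)"
    "\<And>x. x \<in> C \<Longrightarrow> F differentiable (at x) \<longleftrightarrow> f differentiable (at x)"
    using lipschitz_smoothing_off_closed[OF assms(1,3)] by metis
  define G where "G x = arctan (F x)" for x
  have Gb: "\<bar>G x\<bar> \<le> 2" for x
    using arctan_lbound[of "F x"] arctan_ubound[of "F x"] pi_half_less_two
    unfolding G_def by linarith
  have Glip: "L'-lipschitz_on UNIV G"
    using lipschitz_on_compose2[OF F(1) lipschitz_on_subset[OF lipschitz_arctan]] by (simp add: G_def)
  have Gd: "G differentiable (at x) \<longleftrightarrow> F differentiable (at x)" for x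
    using differentiable_arctan_iff[of F x] by (simp add: G_def[abs_def])
  obtain r :: "'a \<Rightarrow> real" and K where dr: "\<And>x. r differentiable (at x)"
    and K: "K-lipschitz_on UNIV r" and r0: "\<And>x. 0 \<le> r x" and r1: "\<And>x. r x \<le> 1"
    and rD: "\<And>x. r x = 0 \<longleftrightarrow> x \<in> D" and rd: "\<And>x c. c \<in> D \<Longrightarrow> r x \<le> (dist x c)\<^sup>2"
    using closed_differentiable_gauge[OF \<open>closed D\<close>] by metis
  define M where "M = L' + 2 * K + 2"
  have LK: "0 \<le> L'" "0 \<le> K" using lipschitz_on_nonneg F(1) K by auto
  then have M: "2 \<le> M" by (simp add: M_def)
  define P where "P x = r x * G x" for x
  have Pb: "\<bar>P x\<bar> \<le> 2 * r x" for x
    using mult_left_mono[OF Gb[of x] r0[of x]] r0[of x] by (simp add: P_def abs_mult)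
  have "M-lipschitz_on UNIV P"
  proof (rule lipschitz_onI)
    fix x y
    have "\<bar>P x - P y\<bar> = \<bar>r x * (G x - G y) + G y * (r x - r y)\<bar>"
      by (simp add: P_def algebra_simps)
    also have "\<dots> \<le> r x * \<bar>G x - G y\<bar> + \<bar>G y\<bar> * \<bar>r x - r y\<bar>"
      using r0[of x] by (metis abs_mult abs_of_nonneg abs_triangle_ineq)
    also have "\<dots> \<le> 1 * (L' * dist x y) + 2 * (K * dist x y)"
      using r0 r1 Gb lipschitz_on_rangeD_abs[OF Glip] lipschitz_on_rangeD_abs[OF K]
      by (intro add_mono mult_mono) auto
    also have "\<dots> \<le> M * dist x y" by (simp add: M_def algebra_simps)
    finally show "dist (P x) (P y) \<le> M * dist x y" by (simp add: dist_real_def)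
  qed (use M in simp)
  from lipschitz_on_cmult_real[OF this, of "1 / M"]
  have 1: "1-lipschitz_on UNIV (\<lambda>x. P x / M)" using M by simp
  have 2: "\<bar>P x / M\<bar> \<le> 1" for x
    using Pb[of x] r1[of x] M by (simp add: abs_divide field_simps)
  have dPM: "(\<lambda>x. P x / M) differentiable (at x) \<longleftrightarrow> P differentiable (at x)" for x
  proof
    assume "(\<lambda>x. P x / M) differentiable (at x)"
    then have "(\<lambda>x. (P x / M) * M) differentiable (at x)" by (intro differentiable_mult) auto
    then show "P differentiable (at x)" using M by simp
  next
    assume "P differentiable (at x)"
    then show "(\<lambda>x. P x / M) differentiable (at x)" using M by (intro differentiable_divide) auto
  qed
  have 3: "P differentiable (at x)" if "x \<notin> C \<or> x \<in> D" for x
  proof (cases "x \<in> D")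
    case True
    have "\<bar>P y\<bar> \<le> 2 * (dist y x)\<^sup>2" for y using Pb[of y] rd[OF True, of y] by linarith
    then show ?thesis by (rule differentiableI[OF has_derivative_zero_if_quadratic])
  next
    case False
    then show ?thesis using that dr F(2) Gd unfolding P_def by (intro differentiable_mult) auto
  qed
  have 4: "\<not> P differentiable (at x)" if x: "x \<in> A - D" for x
  proof
    assume "P differentiable (at x)"
    then have "(\<lambda>y. P y / r y) differentiable (at x)"
      using dr rD x by (intro differentiable_divide) auto
    then obtain Q where Q: "((\<lambda>y. P y / r y) has_derivative Q) (at x)"
      unfolding differentiable_def ..
    have "(G has_derivative Q) (at x)"
      by (rule has_derivative_transform_within_open[OF Q, of "- D"])
         (use x rD \<open>closed D\<close> in \<open>auto simp: P_def\<close>)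
    then have "G differentiable (at x)" by (rule differentiableI)
    then show False using Gd F(3) nd[of x] x \<open>A \<subseteq> C\<close> by auto
  qed
  show ?thesis by (rule that[of "\<lambda>x. P x / M"]) (use 1 2 3 4 dPM in auto)
qed

section \<open>Countable unions of relatively closed sets\<close>

lemma not_universal_differentiability_set_Union_closedin:
  fixes E :: "(real ^ 'd) set" and A :: "nat \<Rightarrow> (real ^ 'd) set"
  assumes cl: "\<And>i. closedin (top_of_set E) (A i)" and E: "E = (\<Union>i. A i)"
    and nu: "\<And>i. \<not> universal_differentiability_set (A i)"
  shows "\<not> universal_differentiability_set E"
proof -
  obtain C where C: "\<And>i. closed (C i)" "\<And>i. A i = E \<inter> C i"
    using cl unfolding closedin_closed by metis
  have "\<exists>(f :: real ^ 'd \<Rightarrow> real) L. L-lipschitz_on UNIV f \<and> (\<forall>x\<in>A i. \<not> f differentiable (at x))" for i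
    using nu[of i] unfolding universal_differentiability_set_def by blast
  then obtain f :: "nat \<Rightarrow> real ^ 'd \<Rightarrow> real" and L where f: "\<And>i. (L i)-lipschitz_on UNIV (f i)"
    "\<And>i x. x \<in> A i \<Longrightarrow> \<not> f i differentiable (at x)"
    by metis
  have "\<exists>g :: real ^ 'd \<Rightarrow> real. 1-lipschitz_on UNIV g \<and> (\<forall>x. \<bar>g x\<bar> \<le> 1) \<and>
     (\<forall>x. x \<notin> C i \<or> x \<in> (\<Union>j<i. C j) \<longrightarrow> g differentiable (at x)) \<and>
     (\<forall>x \<in> A i - (\<Union>j<i. C j). \<not> g differentiable (at x))" for i
  proof -
    have "closed (\<Union>j<i. C j)" using C by auto
    from localized_nondifferentiability[OF C(1)[of i] this f(1)[of i] f(2)[of _ i]] C(2)[of i]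
    show ?thesis by (metis Int_lower2)
  qed
  then obtain g :: "nat \<Rightarrow> real ^ 'd \<Rightarrow> real" where glip: "\<And>i. 1-lipschitz_on UNIV (g i)"
    and gb: "\<And>i x. \<bar>g i x\<bar> \<le> 1"
    and gd: "\<And>i x. x \<notin> C i \<or> x \<in> (\<Union>j<i. C j) \<Longrightarrow> g i differentiable (at x)"
    and gnd: "\<And>i x. x \<in> A i - (\<Union>j<i. C j) \<Longrightarrow> \<not> g i differentiable (at x)"
    by metis
  define M :: "nat \<Rightarrow> real" where "M k = (1/2)^k" for k
  define h where "h k x = M k * g k x" for k x
  have sM: "summable M" unfolding M_def by (rule summable_geometric) simp
  have hlip: "(M k)-lipschitz_on UNIV (h k)" for k
    using lipschitz_on_cmult_real[OF glip, of "M k" k] by (simp add: h_def M_def)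
  have hb: "\<bar>h k x\<bar> \<le> M k" for k x
    using mult_left_mono[OF gb, of "M k" k x] by (simp add: h_def M_def abs_mult)
  define S where "S x = (\<Sum>k. h k x)" for x
  have "(suminf M)-lipschitz_on UNIV S"
    unfolding S_def by (rule lipschitz_on_series[OF hlip hb sM])
  moreover have "\<not> S differentiable (at x)" if "x \<in> E" for x
  proof
    assume Sd: "S differentiable (at x)"
    define n where "n = (LEAST i. x \<in> A i)"
    have n: "x \<in> A n" unfolding n_def using that E by (auto intro: LeastI)
    have "x \<notin> A j" if "j < n" for j using that not_less_Least unfolding n_def by blast
    then have nC: "x \<notin> C j" if "j < n" for j using that C(2)[of j] \<open>x \<in> E\<close> by auto
    have xC: "x \<in> C n" using n C(2) by auto
    have other: "g k differentiable (at x)" if "k \<noteq> n" for k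
      using that nC[of k] xC by (intro gd) (cases "k < n"; auto)
    \<comment> \<open>Deleting the \<open>n\<close>-th term leaves a series that is differentiable at \<open>x\<close>.\<close>
    let ?h = "\<lambda>k y. if k = n then 0 else h k y"
    have "(\<lambda>y. \<Sum>k. ?h k y) differentiable (at x)"
    proof (rule differentiable_lipschitz_series[OF _ _ sM])
      show "(M k)-lipschitz_on UNIV (?h k)" for k
        using hlip[of k] by (cases "k = n") (simp, rule lipschitz_onI, auto simp: M_def)
      show "\<bar>?h k y\<bar> \<le> M k" for k y using hb[of k y] by (auto simp: M_def)
      show "?h k differentiable (at x)" for k
        using other[of k] by (cases "k = n") (auto simp: h_def[abs_def] intro!: differentiable_mult)
    qed
    from differentiable_diff[OF Sd this]
    have "(\<lambda>y. S y - (\<Sum>k. ?h k y)) differentiable (at x)" .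
    moreover have "S y - (\<Sum>k. ?h k y) = h n y" for y
    proof -
      have s1: "summable (\<lambda>k. h k y)"
        by (rule summable_comparison_test'[OF sM, of 0]) (use hb in auto)
      have s2: "summable (\<lambda>k. ?h k y)"
        by (rule summable_comparison_test'[OF sM, of 0]) (use hb in \<open>auto simp: M_def\<close>)
      have "S y - (\<Sum>k. ?h k y) = (\<Sum>k. if k = n then h k y else 0)"
        unfolding S_def suminf_diff[OF s1 s2] by (intro suminf_cong) auto
      also have "\<dots> = h n y" using sums_single[of n "\<lambda>k. h k y"] by (simp add: sums_iff)
      finally show ?thesis .
    qed
    ultimately have "(\<lambda>y. h n y) differentiable (at x)" by simp
    then have "(\<lambda>y. (1 / M n) * h n y) differentiable (at x)" by (intro differentiable_mult) auto
    then have "g n differentiable (at x)" by (simp add: h_def M_def)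
    moreover have "x \<in> A n - (\<Union>j<n. C j)" using n nC by auto
    ultimately show False using gnd by blast
  qed
  ultimately show ?thesis unfolding universal_differentiability_set_def by blast
qed

theorem theorem2p4:
  fixes E :: "(real ^ 'd) set" and A :: "nat \<Rightarrow> (real ^ 'd) set"
  assumes "CARD('d) \<ge> 2"
    and "universal_differentiability_set E"
    and "\<And>i. closedin (top_of_set E) (A i)"
    and "E = (\<Union>i. A i)"
  shows "\<exists>i. universal_differentiability_set (A i)"
  using not_universal_differentiability_set_Union_closedin[OF assms(3,4)] assms(2) by blast

end
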